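(* Let $\alpha>-1$, $t\ge0$, $n\ge1$, let $F(x)$ be the function on $(0,\infty)$ defined by $$F(x)=\beta_nA_n(x)A_{n-1}(x)-\frac{3(A_n'(x))^2}{4A_n^2(x)}+\frac{A_n''(x)-A_n'(x)\mathrm v'(x)-2A_n'(x)B_n(x)}{2A_n(x)}-B_n^2(x)+B_n'(x)-B_n(x)\mathrm v'(x)-\frac{(\mathrm v'(x))^2}{4}+\frac{\mathrm v''(x)}{2},$$ and let $y_1<y_2<y_3<\cdots$ be the zeros of $P_n(x)=P_n(x;t,\alpha)$ in an interval $(c,d)\subset(0,\infty)$. Then: (i) if there exists $M_1>0$ such that $F(x)<M_1$ on $(c,d)$, then $\Delta y_k\equiv y_{k+1}-y_k>\frac{\pi}{\sqrt{M_1}}$, $k=1,2,\dots$; (ii) if there exists $M_2>0$ such that $F(x)>M_2$ on $(c,d)$, then $\Delta y_k\equiv y_{k+1}-y_k<\frac{\pi}{\sqrt{M_2}}$, $k=1,2,\dots$; (iii) if $F$ is strictly increasing on $(c,d)$, then $\Delta^2y_k\equiv y_{k+2}-2y_{k+1}+y_k<0$, $k=1,2,\dots$ (the zeros of $P_n$ in $(c,d)$ are concave); (iv) if $F$ is strictly decreasing on $(c,d)$, then $\Delta^2y_k\equiv y_{k+2}-2y_{k+1}+y_k>0$, $k=1,2,\dots$ (the zeros of $P_n$ in $(c,d)$ are convex). Here $k$ ranges over all indices for which the zeros involved exist.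
   Context: For $\alpha>-1$, $t\ge0$, let $w(x)=w(x;t,\alpha)=x^\alpha e^{-x-t/x}$ on $(0,\infty)$ and $\mathrm v(x)=-\ln w(x)=x+\frac tx-\alpha\ln x$. $P_n(x;t,\alpha)$ are the monic orthogonal polynomials of degree $n$ with respect to $w$: $\int_0^\infty P_jP_kw\,dx=h_j\delta_{jk}$, $h_j>0$. The recurrence coefficients $\alpha_n$, $\beta_n$ (depending on $t,\alpha$; not to be confused with the parameter $\alpha$) are defined by $xP_n=P_{n+1}+\alpha_nP_n+\beta_nP_{n-1}$, $P_0=1$, $\beta_0P_{-1}=0$. Moreover, for $n\ge 0$, $A_n(x)=\frac1x+\frac{\alpha_n-2n-1-\alpha}{x^2}$, and for $n\ge1$, $B_n(x)=-\frac nx+\frac{nt-\beta_n(\alpha_n+\alpha_{n-1}-4n-2\alpha)}{(2n+\alpha)x^2}$. Primes denote $\frac{d}{dx}$. *)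

theory Defs
  imports "HOL-Analysis.Analysis" "HOL-Computational_Algebra.Polynomial"
begin

definition weight :: "real \<Rightarrow> real \<Rightarrow> real \<Rightarrow> real" where
  "weight t \<alpha> x = x powr \<alpha> * exp (- x - t / x)"

definition potential :: "real \<Rightarrow> real \<Rightarrow> real \<Rightarrow> real" where
  "potential t \<alpha> x = - ln (weight t \<alpha> x)"

(* The Lebesgue integrals below converge whenever \<alpha> > -1 and t \<ge> 0, so the convention that a
   divergent integral is 0 plays no role. *)
definition monic_orthogonal :: "(real \<Rightarrow> real) \<Rightarrow> (nat \<Rightarrow> real poly) \<Rightarrow> bool" where
  "monic_orthogonal w P \<longleftrightarrow>
     (\<forall>n. degree (P n) = n \<and> lead_coeff (P n) = 1) \<and>
     (\<exists>h :: nat \<Rightarrow> real. (\<forall>j. h j > 0) \<and>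
        (\<forall>j k. (LBINT x:{0<..}. poly (P j) x * poly (P k) x * w x) = (if j = k then h j else 0)))"

(* The convention \<beta>_0 P_{-1} = 0 is expressed by omitting that term for n = 0; the value b 0 is
   left arbitrary. *)
definition recurrence_coeffs ::
  "(nat \<Rightarrow> real poly) \<Rightarrow> (nat \<Rightarrow> real) \<Rightarrow> (nat \<Rightarrow> real) \<Rightarrow> bool" where
  "recurrence_coeffs P a b \<longleftrightarrow>
     (\<forall>n. [:0, 1:] * P n =
        P (n + 1) + smult (a n) (P n) + (if n = 0 then 0 else smult (b n) (P (n - 1))))"

definition ladder_A :: "real \<Rightarrow> (nat \<Rightarrow> real) \<Rightarrow> nat \<Rightarrow> real \<Rightarrow> real" where
  "ladder_A \<alpha> a n x = 1 / x + (a n - 2 * real n - 1 - \<alpha>) / x\<^sup>2"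

(* Only meaningful for n \<ge> 1. *)
definition ladder_B ::
  "real \<Rightarrow> real \<Rightarrow> (nat \<Rightarrow> real) \<Rightarrow> (nat \<Rightarrow> real) \<Rightarrow> nat \<Rightarrow> real \<Rightarrow> real" where
  "ladder_B t \<alpha> a b n x =
     - real n / x +
     (real n * t - b n * (a n + a (n - 1) - 4 * real n - 2 * \<alpha>)) / ((2 * real n + \<alpha>) * x\<^sup>2)"

(* Only meaningful for n \<ge> 1 and x > 0. *)
definition sturm_F ::
  "real \<Rightarrow> real \<Rightarrow> (nat \<Rightarrow> real) \<Rightarrow> (nat \<Rightarrow> real) \<Rightarrow> nat \<Rightarrow> real \<Rightarrow> real" where
  "sturm_F t \<alpha> a b n x =
     (let v = potential t \<alpha>; A = ladder_A \<alpha> a n; A1 = ladder_A \<alpha> a (n - 1);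
          B = ladder_B t \<alpha> a b n
      in b n * A x * A1 x
         - 3 * (deriv A x)\<^sup>2 / (4 * (A x)\<^sup>2)
         + (deriv (deriv A) x - deriv A x * deriv v x - 2 * deriv A x * B x) / (2 * A x)
         - (B x)\<^sup>2 + deriv B x - B x * deriv v x
         - (deriv v x)\<^sup>2 / 4 + deriv (deriv v) x / 2)"

end

theory Submission
  imports Defs "HOL-Real_Asymp.Real_Asymp"
begin

text \<open>Integration by parts against the weight turns orthogonality into the lowering and raising
  relations \<open>P\<^sub>n' = - B\<^sub>n P\<^sub>n + \<beta>\<^sub>n A\<^sub>n P\<^sub>n\<^sub>-\<^sub>1\<close> and
  \<open>P\<^sub>n\<^sub>-\<^sub>1' = (B\<^sub>n + v') P\<^sub>n\<^sub>-\<^sub>1 - A\<^sub>n\<^sub>-\<^sub>1 P\<^sub>n\<close>. They make \<open>u = P\<^sub>n exp (- v / 2) / sqrt A\<^sub>n\<close> a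
  solution of \<open>u'' + F u = 0\<close> on the positive half-line, where \<open>A\<^sub>n\<close> is positive and \<open>u\<close> has the
  zeros of \<open>P\<^sub>n\<close>. Sturm comparison of \<open>u\<close> with \<open>sin (sqrt M (x - y\<^sub>k))\<close> bounds the gaps between
  zeros; comparison of \<open>u\<close> with its own reflection in the middle one of three consecutive zeros
  gives concavity and convexity.\<close>

subsection \<open>Sturm comparison\<close>

text \<open>The Wronskian \<open>u' * v - u * v'\<close> has derivative
  \<open>(g - f) * u * v\<close>, positive inside the interval, so it increases strictly from
  \<open>p\<close> to \<open>q\<close>. At the zeros of \<open>u\<close> it reduces to
  \<open>u' p * v p\<close> and \<open>u' q * v q\<close>; the sign of \<open>u\<close> makes the
  first nonnegative and the second nonpositive. That \<open>v\<close> is nonnegative at the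
  endpoints follows by continuity.\<close>

lemma sturm_comparison_pos:
  fixes u u' v v' f g :: "real \<Rightarrow> real"
  assumes "p < q"
    and u: "\<And>x. x \<in> {p..q} \<Longrightarrow> (u has_real_derivative u' x) (at x)"
    and u': "\<And>x. x \<in> {p..q} \<Longrightarrow> (u' has_real_derivative - f x * u x) (at x)"
    and v: "\<And>x. x \<in> {p..q} \<Longrightarrow> (v has_real_derivative v' x) (at x)"
    and v': "\<And>x. x \<in> {p..q} \<Longrightarrow> (v' has_real_derivative - g x * v x) (at x)"
    and fg: "\<And>x. x \<in> {p<..<q} \<Longrightarrow> f x < g x"
    and up: "\<And>x. x \<in> {p<..<q} \<Longrightarrow> u x > 0"
    and vp: "\<And>x. x \<in> {p<..<q} \<Longrightarrow> v x > 0"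
    and "u p = 0" "u q = 0"
  shows False
proof -
  let ?W = "\<lambda>x. u' x * v x - u x * v' x"
  have DW: "(?W has_real_derivative (g x - f x) * (u x * v x)) (at x)" if "x \<in> {p..q}" for x
    using u[OF that] u'[OF that] v[OF that] v'[OF that]
    by (auto intro!: derivative_eq_intros simp: algebra_simps)
  have "?W p < ?W q"
  proof (rule DERIV_pos_imp_increasing_open[OF \<open>p < q\<close>])
    show "\<exists>y. (?W has_real_derivative y) (at x) \<and> 0 < y" if "p < x" "x < q" for x
      using DW[of x] that fg[of x] up[of x] vp[of x]
      by (intro exI[of _ "(g x - f x) * (u x * v x)"]) auto
    show "continuous_on {p..q} ?W"
      using DW by (meson DERIV_isCont continuous_at_imp_continuous_on)
  qed
  moreover have "u' p \<ge> 0"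
  proof (rule ccontr)
    assume "\<not> u' p \<ge> 0"
    then obtain d where "d > 0" "\<And>h. 0 < h \<Longrightarrow> h < d \<Longrightarrow> u p > u (p + h)"
      using DERIV_neg_dec_right[OF u[of p]] \<open>p < q\<close> by auto
    moreover obtain h where "0 < h" "h < d" "h < q - p"
      using \<open>d > 0\<close> \<open>p < q\<close> field_lbound_gt_zero[of d "q - p"] by auto
    ultimately show False using up[of "p + h"] \<open>u p = 0\<close> by force
  qed
  moreover have "u' q \<le> 0"
  proof (rule ccontr)
    assume "\<not> u' q \<le> 0"
    then obtain d where "d > 0" "\<And>h. 0 < h \<Longrightarrow> h < d \<Longrightarrow> u (q - h) < u q"
      using DERIV_pos_inc_left[OF u[of q]] \<open>p < q\<close> by auto
    moreover obtain h where "0 < h" "h < d" "h < q - p"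
      using \<open>d > 0\<close> \<open>p < q\<close> field_lbound_gt_zero[of d "q - p"] by auto
    ultimately show False using up[of "q - h"] \<open>u q = 0\<close> by force
  qed
  moreover have "v p \<ge> 0"
  proof (rule tendsto_lowerbound)
    show "(v \<longlongrightarrow> v p) (at_right p)"
      using v[of p] \<open>p < q\<close> by (auto dest: DERIV_isCont simp: isCont_def filterlim_at_split)
    show "eventually (\<lambda>x. 0 \<le> v x) (at_right p)"
      unfolding eventually_at_right_field using vp \<open>p < q\<close> by (force intro: less_imp_le)
  qed auto
  moreover have "v q \<ge> 0"
  proof (rule tendsto_lowerbound)
    show "(v \<longlongrightarrow> v q) (at_left q)"
      using v[of q] \<open>p < q\<close> by (auto dest: DERIV_isCont simp: isCont_def filterlim_at_split)
    show "eventually (\<lambda>x. 0 \<le> v x) (at_left q)"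
      unfolding eventually_at_left_field using vp \<open>p < q\<close> by (force intro: less_imp_le)
  qed auto
  ultimately have "0 \<le> u' p * v p" "u' q * v q \<le> 0" "u' p * v p < u' q * v q"
    using \<open>u p = 0\<close> \<open>u q = 0\<close> by (simp_all add: mult_nonpos_nonneg)
  thus False by linarith
qed

text \<open>The image of an interval under a continuous function is connected. The sign is returned
  as a factor \<open>s\<close>, because \<open>s * u\<close> still solves any linear equation that
  \<open>u\<close> solves.\<close>

lemma constant_sign_on_interval:
  fixes u :: "real \<Rightarrow> real"
  assumes "continuous_on {p<..<q} u" and "\<And>x. x \<in> {p<..<q} \<Longrightarrow> u x \<noteq> 0"
  obtains s where "s \<in> {1, -1}" "\<And>x. x \<in> {p<..<q} \<Longrightarrow> s * u x > 0"
proof -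
  have "connected (u ` {p<..<q})"
    using assms(1) by (intro connected_continuous_image) auto
  moreover have "0 \<notin> u ` {p<..<q}" using assms(2) by force
  ultimately have "(\<forall>x\<in>{p<..<q}. u x > 0) \<or> (\<forall>x\<in>{p<..<q}. u x < 0)"
    unfolding connected_iff_interval by (smt (verit) imageI assms(2))
  thus ?thesis using that[of 1] that[of "-1"] by auto
qed

text \<open>If \<open>v\<close> had no zero inside, both functions would have constant sign there,
  and scaling each by its sign would contradict the positive case.\<close>

lemma sturm_comparison:
  fixes u u' v v' f g :: "real \<Rightarrow> real"
  assumes "p < q"
    and u: "\<And>x. x \<in> {p..q} \<Longrightarrow> (u has_real_derivative u' x) (at x)"
    and u': "\<And>x. x \<in> {p..q} \<Longrightarrow> (u' has_real_derivative - f x * u x) (at x)"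
    and v: "\<And>x. x \<in> {p..q} \<Longrightarrow> (v has_real_derivative v' x) (at x)"
    and v': "\<And>x. x \<in> {p..q} \<Longrightarrow> (v' has_real_derivative - g x * v x) (at x)"
    and fg: "\<And>x. x \<in> {p<..<q} \<Longrightarrow> f x < g x"
    and nz: "\<And>x. x \<in> {p<..<q} \<Longrightarrow> u x \<noteq> 0"
    and "u p = 0" "u q = 0"
  shows "\<exists>x\<in>{p<..<q}. v x = 0"
proof (rule ccontr)
  assume "\<not> ?thesis"
  hence nzv: "v x \<noteq> 0" if "x \<in> {p<..<q}" for x using that by auto
  have "continuous_on {p<..<q} u" "continuous_on {p<..<q} v"
    by (auto intro!: continuous_at_imp_continuous_on DERIV_isCont[OF u] DERIV_isCont[OF v])
  then obtain s s' where s: "\<And>x. x \<in> {p<..<q} \<Longrightarrow> s * u x > 0"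
    and s': "\<And>x. x \<in> {p<..<q} \<Longrightarrow> s' * v x > 0"
    using constant_sign_on_interval[of p q u] constant_sign_on_interval[of p q v] nz nzv by metis
  show False
  proof (rule sturm_comparison_pos[where u = "\<lambda>x. s * u x" and v = "\<lambda>x. s' * v x" and f = f and g = g])
    show "((\<lambda>x. s * u x) has_real_derivative s * u' x) (at x)"
      "((\<lambda>x. s * u' x) has_real_derivative - f x * (s * u x)) (at x)"
      "((\<lambda>x. s' * v x) has_real_derivative s' * v' x) (at x)"
      "((\<lambda>x. s' * v' x) has_real_derivative - g x * (s' * v x)) (at x)" if "x \<in> {p..q}" for x
      using u[OF that] u'[OF that] v[OF that] v'[OF that] by (auto intro!: derivative_eq_intros)
  qed (use assms s s' in auto)
qed

lemma has_real_derivative_reflect: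
  fixes f :: "real \<Rightarrow> real"
  assumes "(f has_real_derivative D) (at (q - x))"
  shows "((\<lambda>x. f (q - x)) has_real_derivative - D) (at x)"
proof -
  have "((\<lambda>x. q - x) has_real_derivative -1) (at x)" by (auto intro!: derivative_eq_intros)
  from DERIV_chain2[where f = f and g = "\<lambda>x. q - x", OF assms this] show ?thesis by simp
qed

lemma has_real_derivative_shift:
  fixes f :: "real \<Rightarrow> real"
  assumes "(f has_real_derivative D) (at (q + x))"
  shows "((\<lambda>x. f (q + x)) has_real_derivative D) (at x)"
proof -
  have "((\<lambda>x. q + x) has_real_derivative 1) (at x)" by (auto intro!: derivative_eq_intros)
  from DERIV_chain2[where f = f and g = "\<lambda>x. q + x", OF assms this] show ?thesis by simp
qed

section \<open>Spacing of the zeros of a solution of u'' + F u = 0\<close>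

context
  fixes u u' F :: "real \<Rightarrow> real" and I :: "real set"
  assumes I: "is_interval I"
    and u: "\<And>x. x \<in> I \<Longrightarrow> (u has_real_derivative u' x) (at x)"
    and u': "\<And>x. x \<in> I \<Longrightarrow> (u' has_real_derivative - F x * u x) (at x)"
begin

text \<open>The sine with frequency \<open>sqrt M\<close> solves the equation with the larger
  coefficient \<open>M\<close>, so it must vanish strictly between \<open>p\<close> and
  \<open>q\<close>. Its first zero after \<open>p\<close> is at distance
  \<open>pi / sqrt M\<close>.\<close>

lemma zero_gap_greater:
  assumes "p \<in> I" "q \<in> I" "p < q" "u p = 0" "u q = 0" "\<And>x. x \<in> {p<..<q} \<Longrightarrow> u x \<noteq> 0"
    and "M > 0" "\<And>x. x \<in> I \<Longrightarrow> F x < M"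
  shows "q - p > pi / sqrt M"
proof (rule ccontr)
  assume "\<not> ?thesis"
  hence le: "sqrt M * (q - p) \<le> pi" using \<open>M > 0\<close> by (simp add: field_simps)
  have sub: "x \<in> I" if "x \<in> {p..q}" for x
    using that assms I unfolding is_interval_1 by (meson atLeastAtMost_iff)
  have "\<exists>x\<in>{p<..<q}. sin (sqrt M * (x - p)) = 0"
  proof (rule sturm_comparison[where u = u and u' = u' and f = F and g = "\<lambda>_. M"])
    show "((\<lambda>x. sin (sqrt M * (x - p))) has_real_derivative sqrt M * cos (sqrt M * (x - p))) (at x)"
      "((\<lambda>x. sqrt M * cos (sqrt M * (x - p))) has_real_derivative - M * sin (sqrt M * (x - p))) (at x)" for x
      using \<open>M > 0\<close> by (auto intro!: derivative_eq_intros)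
  qed (use assms u u' sub in auto)
  then obtain x where x: "p < x" "x < q" "sin (sqrt M * (x - p)) = 0" by auto
  have "sqrt M * (x - p) < sqrt M * (q - p)" using x \<open>M > 0\<close> by simp
  with le have "sqrt M * (x - p) < pi" by linarith
  moreover have "0 < sqrt M * (x - p)" using x \<open>M > 0\<close> by simp
  ultimately have "sin (sqrt M * (x - p)) > 0" by (intro sin_gt_zero)
  with x show False by simp
qed

text \<open>Now the sine has the smaller coefficient. Its consecutive zeros are \<open>p\<close> and
  \<open>q'\<close>, so \<open>u\<close> would vanish between them, hence inside the interval from
  \<open>p\<close> to \<open>q\<close> if \<open>q'\<close> did not exceed \<open>q\<close>.\<close>

lemma zero_gap_less:
  assumes "p \<in> I" "q \<in> I" "p < q" "\<And>x. x \<in> {p<..<q} \<Longrightarrow> u x \<noteq> 0"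
    and "M > 0" "\<And>x. x \<in> I \<Longrightarrow> F x > M"
  shows "q - p < pi / sqrt M"
proof (rule ccontr)
  assume neg: "\<not> ?thesis"
  define q' where "q' = p + pi / sqrt M"
  have q': "p < q'" "q' \<le> q" using neg \<open>M > 0\<close> by (auto simp: q'_def)
  have sub: "x \<in> I" if "x \<in> {p..q'}" for x
    using that assms q' I unfolding is_interval_1 by (meson atLeastAtMost_iff order_trans)
  have "\<exists>x\<in>{p<..<q'}. u x = 0"
  proof (rule sturm_comparison[where v = u and v' = u' and g = F and f = "\<lambda>_. M"])
    show "((\<lambda>x. sin (sqrt M * (x - p))) has_real_derivative sqrt M * cos (sqrt M * (x - p))) (at x)"
      "((\<lambda>x. sqrt M * cos (sqrt M * (x - p))) has_real_derivative - M * sin (sqrt M * (x - p))) (at x)" for x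
      using \<open>M > 0\<close> by (auto intro!: derivative_eq_intros)
    show "sin (sqrt M * (x - p)) \<noteq> 0" if "x \<in> {p<..<q'}" for x
    proof -
      have "sqrt M * (x - p) < sqrt M * (q' - p)" using that \<open>M > 0\<close> by simp
      also have "\<dots> = pi" using \<open>M > 0\<close> by (simp add: q'_def)
      finally have "sin (sqrt M * (x - p)) > 0" using that \<open>M > 0\<close> by (intro sin_gt_zero) auto
      thus ?thesis by simp
    qed
  qed (use assms q' u u' sub in \<open>auto simp: q'_def\<close>)
  thus False using assms q' by auto
qed

text \<open>Reflection in \<open>q\<close> turns the left piece of \<open>u\<close> into a solution
  with coefficient \<open>F (q - x)\<close>, smaller than the coefficient \<open>F (q + x)\<close>
  of the right piece. If the right gap were at least as long as the left one, comparison over the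
  length \<open>q - p\<close> would produce a zero of \<open>u\<close> strictly between
  \<open>q\<close> and \<open>r\<close>.\<close>

lemma zero_gaps_decrease:
  assumes "p \<in> I" "r \<in> I" "p < q" "q < r" "u p = 0" "u q = 0" "\<And>x. x \<in> {p<..<q} \<Longrightarrow> u x \<noteq> 0"
    "\<And>x. x \<in> {q<..<r} \<Longrightarrow> u x \<noteq> 0" and mono: "strict_mono_on I F"
  shows "r - q < q - p"
proof (rule ccontr)
  assume "\<not> ?thesis"
  hence le: "q - p \<le> r - q" by simp
  have sub: "q - x \<in> I" "q + x \<in> I" if "x \<in> {0..q-p}" for x
    using that assms le I unfolding is_interval_1
    by (smt (verit) atLeastAtMost_iff)+
  have "\<exists>x\<in>{0<..<q-p}. u (q + x) = 0"
  proof (rule sturm_comparison[where u = "\<lambda>x. u (q - x)" and u' = "\<lambda>x. - u' (q - x)" and f = "\<lambda>x. F (q - x)"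
        and v' = "\<lambda>x. u' (q + x)" and g = "\<lambda>x. F (q + x)"])
    show "((\<lambda>x. u (q - x)) has_real_derivative - u' (q - x)) (at x)"
      "((\<lambda>x. - u' (q - x)) has_real_derivative - F (q - x) * u (q - x)) (at x)"
      "((\<lambda>x. u (q + x)) has_real_derivative u' (q + x)) (at x)"
      "((\<lambda>x. u' (q + x)) has_real_derivative - F (q + x) * u (q + x)) (at x)" if "x \<in> {0..q-p}" for x
      using has_real_derivative_reflect[OF u[OF sub(1)[OF that]]] has_real_derivative_reflect[OF u'[OF sub(1)[OF that]]]
        has_real_derivative_shift[OF u[OF sub(2)[OF that]]] has_real_derivative_shift[OF u'[OF sub(2)[OF that]]]
      by (auto dest: DERIV_minus)
    show "F (q - x) < F (q + x)" if "x \<in> {0<..<q-p}" for x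
      using that sub[of x] mono by (auto simp: strict_mono_on_def)
  qed (use assms in auto)
  thus False using assms(8) le by force
qed

text \<open>The mirror image: the left piece now has the larger coefficient, so comparison over the
  length \<open>r - q\<close> would produce a zero strictly between \<open>p\<close> and
  \<open>q\<close>.\<close>

lemma zero_gaps_increase:
  assumes "p \<in> I" "r \<in> I" "p < q" "q < r" "u q = 0" "u r = 0" "\<And>x. x \<in> {p<..<q} \<Longrightarrow> u x \<noteq> 0"
    "\<And>x. x \<in> {q<..<r} \<Longrightarrow> u x \<noteq> 0" and mono: "strict_antimono_on I F"
  shows "r - q > q - p"
proof (rule ccontr)
  assume "\<not> ?thesis"
  hence le: "q - p \<ge> r - q" by simp
  have sub: "q - x \<in> I" "q + x \<in> I" if "x \<in> {0..r-q}" for x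
    using that assms le I unfolding is_interval_1
    by (smt (verit) atLeastAtMost_iff)+
  have "\<exists>x\<in>{0<..<r-q}. u (q - x) = 0"
  proof (rule sturm_comparison[where v = "\<lambda>x. u (q - x)" and v' = "\<lambda>x. - u' (q - x)" and g = "\<lambda>x. F (q - x)"
        and u = "\<lambda>x. u (q + x)" and u' = "\<lambda>x. u' (q + x)" and f = "\<lambda>x. F (q + x)"])
    show "((\<lambda>x. u (q - x)) has_real_derivative - u' (q - x)) (at x)"
      "((\<lambda>x. - u' (q - x)) has_real_derivative - F (q - x) * u (q - x)) (at x)"
      "((\<lambda>x. u (q + x)) has_real_derivative u' (q + x)) (at x)"
      "((\<lambda>x. u' (q + x)) has_real_derivative - F (q + x) * u (q + x)) (at x)" if "x \<in> {0..r-q}" for x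
      using has_real_derivative_reflect[OF u[OF sub(1)[OF that]]] has_real_derivative_reflect[OF u'[OF sub(1)[OF that]]]
        has_real_derivative_shift[OF u[OF sub(2)[OF that]]] has_real_derivative_shift[OF u'[OF sub(2)[OF that]]]
      by (auto dest: DERIV_minus)
    show "F (q + x) < F (q - x)" if "x \<in> {0<..<r-q}" for x
      using that sub[of x] mono by (auto simp: monotone_on_def)
  qed (use assms in auto)
  thus False using assms(7) le by force
qed

end

section \<open>From the ladder system to an equation without first-order term\<close>

text \<open>Eliminating \<open>q\<close> gives a second-order equation for \<open>p\<close> in which
  p' has coefficient \<open>- (v' + A' / A)\<close>. The factor
  \<open>exp (- v / 2) / sqrt A\<close> has logarithmic derivative
  \<open>- (v' + A' / A) / 2\<close> and removes that term. Since \<open>u'\<close> is written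
  through \<open>p\<close> and \<open>q\<close>, it can be differentiated at \<open>x\<close>
  knowing both ladder relations at that point only.\<close>

lemma ladder_normal_form:
  fixes A A' A'' B B' C v v' v'' p q :: "real \<Rightarrow> real" and \<beta> :: real
  defines "F \<equiv> \<lambda>x. \<beta> * A x * C x - 3 * (A' x)\<^sup>2 / (4 * (A x)\<^sup>2)
         + (A'' x - A' x * v' x - 2 * A' x * B x) / (2 * A x)
         - (B x)\<^sup>2 + B' x - B x * v' x - (v' x)\<^sup>2 / 4 + v'' x / 2"
    and "u \<equiv> \<lambda>x. p x * (exp (- v x / 2) / sqrt (A x))"
    and "u' \<equiv> \<lambda>x. (- B x * p x + \<beta> * A x * q x - (v' x + A' x / A x) / 2 * p x) * (exp (- v x / 2) / sqrt (A x))"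
  assumes A: "A x > 0" "(A has_real_derivative A' x) (at x)" "(A' has_real_derivative A'' x) (at x)"
    and B: "(B has_real_derivative B' x) (at x)"
    and v: "(v has_real_derivative v' x) (at x)" "(v' has_real_derivative v'' x) (at x)"
    and p: "(p has_real_derivative - B x * p x + \<beta> * A x * q x) (at x)"
    and q: "(q has_real_derivative (B x + v' x) * q x - C x * p x) (at x)"
  shows "(u has_real_derivative u' x) (at x)"
    and "(u' has_real_derivative - F x * u x) (at x)"
proof -
  let ?\<phi> = "\<lambda>x. exp (- v x / 2) / sqrt (A x)"
  have alg1: "P * w + - G / 2 * w * r = (P - G / 2 * r) * w" for P G w r :: real
    by (simp add: field_simps)
  \<comment> \<open>The letters stand for the values at \<open>x\<close>, with \<open>g\<close> for
    A'/A and \<open>h\<close> for A''/A, so that no division by \<open>A\<close> is left. All terms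
    containing \<open>s\<close>, the value of \<open>q\<close>, cancel.\<close>
  have alg2: "- b1 * r - b * (- b * r + \<beta> * a * s) + \<beta> * (g * a) * s + \<beta> * a * ((b + w1) * s - c * r)
      - (w2 + h - g\<^sup>2) / 2 * r - (w1 + g) / 2 * (- b * r + \<beta> * a * s)
      - (w1 + g) / 2 * (- b * r + \<beta> * a * s - (w1 + g) / 2 * r)
    = - (\<beta> * a * c - 3 / 4 * g\<^sup>2 + (h - g * w1 - 2 * g * b) / 2
         - b\<^sup>2 + b1 - b * w1 - w1\<^sup>2 / 4 + w2 / 2) * r" for a b b1 c g h r s w1 w2 :: real
    by (simp add: algebra_simps add_divide_distrib diff_divide_distrib power2_eq_square)
  define g where "g = A' x / A x"
  define h where "h = A'' x / A x"
  have A': "A' x = g * A x" and A'': "A'' x = h * A x"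
    using A by (auto simp: g_def h_def)
  have \<phi>: "(?\<phi> has_real_derivative - (v' x + A' x / A x) / 2 * ?\<phi> x) (at x)"
    using A v by (auto intro!: derivative_eq_intros simp: field_simps)
  show "(u has_real_derivative u' x) (at x)"
    unfolding u_def u'_def
    by (rule DERIV_cong[OF DERIV_mult[OF p \<phi>]]) (simp only: alg1)
  have *: "((\<lambda>x. - B x * p x + \<beta> * A x * q x - (v' x + A' x / A x) / 2 * p x) has_real_derivative
     (- B' x * p x - B x * (- B x * p x + \<beta> * A x * q x) + \<beta> * A' x * q x + \<beta> * A x * ((B x + v' x) * q x - C x * p x)
      - (v'' x + A'' x / A x - (A' x / A x)\<^sup>2) / 2 * p x
      - (v' x + A' x / A x) / 2 * (- B x * p x + \<beta> * A x * q x))) (at x)"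
    using A by (auto intro!: derivative_eq_intros p q A B v simp: field_simps power2_eq_square)
  have F: "F x = \<beta> * A x * C x - 3 / 4 * g\<^sup>2 + (h - g * v' x - 2 * g * B x) / 2
         - (B x)\<^sup>2 + B' x - B x * v' x - (v' x)\<^sup>2 / 4 + v'' x / 2"
    using A(1) by (simp add: F_def A' A'' power_mult_distrib) (simp add: field_simps)
  have eq: "A' x / A x = g" "A'' x / A x = h" using A(1) by (auto simp: A' A'')
  show "(u' has_real_derivative - F x * u x) (at x)"
    unfolding u_def u'_def F
    by (rule DERIV_cong[OF DERIV_mult[OF * \<phi>]], unfold eq, unfold A' alg1 alg2) (simp only: mult.assoc)
qed

subsection \<open>Polynomials integrated against the weight\<close>

abbreviation X :: "real poly" where "X \<equiv> monom 1 (Suc 0)"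

text \<open>This is Euler's integral for the Gamma function at \<open>s + 1\<close>.\<close>

lemma set_integrable_powr_exp:
  assumes "s > (-1::real)"
  shows "set_integrable lborel {0<..} (\<lambda>x. x powr s * exp (- x))"
proof -
  have "(\<integral>\<^sup>+x. ennreal (indicator {0..} x * x powr s / exp x) \<partial>lborel) < \<infinity>"
    using Gamma_conv_nn_integral_real[of "s + 1"] assms by (simp flip: infinity_ennreal_def)
      (metis ennreal_less_top infinity_ennreal_def)
  hence "integrable lborel (\<lambda>x. indicator {0..} x * x powr s / exp x)"
    by (intro integrableI_nonneg) auto
  hence "set_integrable lborel {0..} (\<lambda>x. x powr s * exp (- x))"
    by (simp add: set_integrable_def exp_minus field_simps)
  thus ?thesis by (rule set_integrable_subset) auto
qed

text \<open>Induction on the polynomial with \<open>s\<close> arbitrary: the factor \<open>x\<close>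
  split off by \<open>pCons\<close> is absorbed into the power. The general \<open>g\<close> covers
  the exponential factor of the weight both alone and multiplied by \<open>t / x\<close>.\<close>

lemma set_integrable_poly_powr:
  fixes g :: "real \<Rightarrow> real" and s :: real
  assumes "s > -1" and [measurable]: "g \<in> borel_measurable borel"
    and g: "\<And>x. x > 0 \<Longrightarrow> \<bar>g x\<bar> \<le> exp (- x)"
  shows "set_integrable lborel {0<..} (\<lambda>x. poly q x * (x powr s * g x))"
  using \<open>s > -1\<close>
proof (induction q arbitrary: s)
  case 0
  show ?case by (simp add: set_integrable_def)
next
  case (pCons c q)
  have "set_integrable lborel {0<..} (\<lambda>x. x powr s * g x)"
  proof (rule set_integrable_bound[OF set_integrable_powr_exp[of s]])
    show "AE x in lborel. x \<in> {0<..} \<longrightarrow> norm (x powr s * g x) \<le> norm (x powr s * exp (- x))"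
      using g by (intro AE_I2) (auto simp: abs_mult intro!: mult_left_mono)
  qed (use pCons.prems in \<open>auto simp: set_borel_measurable_def\<close>)
  hence "set_integrable lborel {0<..} (\<lambda>x. c * (x powr s * g x) + poly q x * (x powr (s + 1) * g x))"
    using pCons.IH[of "s + 1"] pCons.prems by (intro set_integral_add set_integrable_mult_right) auto
  thus ?case
    by (rule set_integrable_cong[THEN iffD1, rotated -1]) (auto simp: powr_add algebra_simps)
qed

lemma set_integrable_poly_weight:
  assumes "\<alpha> > -1" "t \<ge> 0"
  shows "set_integrable lborel {0<..} (\<lambda>x. poly q x * weight t \<alpha> x)"
  unfolding weight_def by (rule set_integrable_poly_powr[OF assms(1)]) (use assms(2) in auto)

text \<open>The bound u exp(-u) \<le> 1 at u = t/x lets the exponential absorb the singular factor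
  \<open>t / x\<close>.\<close>

lemma set_integrable_poly_weight_div:
  assumes "\<alpha> > -1" "t \<ge> 0"
  shows "set_integrable lborel {0<..} (\<lambda>x. poly q x * (t / x * weight t \<alpha> x))"
proof -
  have *: "\<bar>t / x * exp (- x - t / x)\<bar> \<le> exp (- x)" if "x > 0" for x
  proof -
    have "u * exp (- u) \<le> 1" for u :: real
    proof -
      have "u \<le> exp u" using exp_ge_add_one_self[of u] by linarith
      thus ?thesis by (simp add: exp_minus pos_divide_le_eq flip: divide_inverse)
    qed
    hence "t / x * exp (- (t / x)) \<le> 1" .
    hence "exp (- x) * (t / x * exp (- (t / x))) \<le> exp (- x)" by (intro mult_left_le) auto
    moreover have "exp (- x - t / x) = exp (- x) * exp (- (t / x))" by (simp flip: exp_add)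
    moreover have "t / x * exp (- x - t / x) \<ge> 0" using that assms(2) by simp
    ultimately show ?thesis by (simp add: mult_ac)
  qed
  show ?thesis
    unfolding weight_def mult.left_commute[of "t / _"]
    by (rule set_integrable_poly_powr[OF assms(1)]) (use * in auto)
qed

lemma tendsto_poly_powr_exp_at_top:
  "((\<lambda>x. poly q x * (x powr s * exp (- x))) \<longlongrightarrow> 0) at_top" for s :: real
proof (induction q arbitrary: s)
  case (pCons c q)
  have "((\<lambda>x::real. x powr s * exp (- x)) \<longlongrightarrow> 0) at_top" by real_asymp
  hence "((\<lambda>x. c * (x powr s * exp (- x)) + poly q x * (x powr (s + 1) * exp (- x))) \<longlongrightarrow> c * 0 + 0) at_top"
    by (intro tendsto_add tendsto_mult_left pCons.IH)
  moreover have "eventually (\<lambda>x. c * (x powr s * exp (- x)) + poly q x * (x powr (s + 1) * exp (- x))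
      = poly (pCons c q) x * (x powr s * exp (- x))) at_top"
    using eventually_gt_at_top[of 0] by eventually_elim (simp add: powr_add algebra_simps)
  ultimately show ?case by (simp cong: filterlim_cong)
qed simp

text \<open>The integrand is the derivative of x q w, because x w' = (\<alpha> - x + t/x) w. The
  boundary terms vanish: at 0 since the power of x is \<alpha> + 1 > 0, at infinity by exponential
  decay. For both limits exp(-t/x) \<le> 1 is dropped.\<close>

lemma weight_integral_by_parts:
  assumes "\<alpha> > -1" "t \<ge> 0"
  shows "(LBINT x:{0<..}. poly (q + X * pderiv q + smult \<alpha> q - X * q) x * weight t \<alpha> x
            + poly q x * (t / x * weight t \<alpha> x)) = 0"
proof -
  let ?f = "\<lambda>x. poly (q + X * pderiv q + smult \<alpha> q - X * q) x * weight t \<alpha> x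
            + poly q x * (t / x * weight t \<alpha> x)"
  let ?G = "\<lambda>x. poly q x * (x powr (\<alpha> + 1) * exp (- x - t / x))"
  have le: "norm (?G x) \<le> norm (poly q x * (x powr (\<alpha> + 1) * exp (- x)))" if "x > 0" for x
    using that assms(2) by (auto simp: abs_mult intro!: mult_left_mono)
  have "(LBINT x=ereal 0..\<infinity>. ?f x) = 0 - 0"
  proof (rule interval_integral_FTC_integrable)
    fix x assume x: "ereal 0 < ereal x"
    show "(?G has_vector_derivative ?f x) (at x)"
      unfolding has_real_derivative_iff_has_vector_derivative[symmetric]
    proof (rule DERIV_cong[OF DERIV_mult[OF poly_DERIV DERIV_mult]])
      show "((\<lambda>x. x powr (\<alpha> + 1)) has_real_derivative (\<alpha> + 1) * x powr \<alpha>) (at x)"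
        using has_real_derivative_powr[of x "\<alpha> + 1"] x by simp
      show "((\<lambda>x. exp (- x - t / x)) has_real_derivative exp (- x - t / x) * (t / x\<^sup>2 - 1)) (at x)"
        using x by (auto intro!: derivative_eq_intros simp: power2_eq_square)
    qed (use x in \<open>simp add: weight_def poly_monom powr_add power2_eq_square field_simps\<close>)
    show "isCont ?f x"
      using x unfolding weight_def by (auto intro!: continuous_intros)
  next
    have "einterval (ereal 0) \<infinity> = {0<..}" by (auto simp: einterval_def)
    thus "set_integrable lborel (einterval (ereal 0) \<infinity>) ?f"
      using assms set_integrable_poly_weight set_integrable_poly_weight_div by (simp only: set_integral_add)
  next
    have "((\<lambda>x. poly q x * (x powr (\<alpha> + 1) * exp (- x))) \<longlongrightarrow> poly q 0 * (0 powr (\<alpha> + 1) * exp (- 0))) (at_right 0)"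
      using assms(1) by (intro tendsto_intros) (auto intro: eventually_mono[OF eventually_at_right_less])
    hence lim: "((\<lambda>x. poly q x * (x powr (\<alpha> + 1) * exp (- x))) \<longlongrightarrow> 0) (at_right 0)"
      using assms(1) by simp
    have "eventually (\<lambda>x. norm (?G x) \<le> norm (poly q x * (x powr (\<alpha> + 1) * exp (- x)))) (at_right 0)"
      using eventually_at_right_less[of 0] by eventually_elim (rule le)
    hence "(?G \<longlongrightarrow> 0) (at_right 0)"
      using tendsto_norm_zero[OF lim] by (rule Lim_null_comparison)
    thus "((?G \<circ> real_of_ereal) \<longlongrightarrow> 0) (at_right (ereal 0))"
      unfolding ereal_tendsto_simps .
  next
    have "eventually (\<lambda>x. norm (?G x) \<le> norm (poly q x * (x powr (\<alpha> + 1) * exp (- x)))) at_top"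
      using eventually_gt_at_top[of 0] by eventually_elim (rule le)
    hence "(?G \<longlongrightarrow> 0) at_top"
      using tendsto_norm_zero[OF tendsto_poly_powr_exp_at_top[of q "\<alpha> + 1"]] by (rule Lim_null_comparison)
    thus "((?G \<circ> real_of_ereal) \<longlongrightarrow> 0) (at_left \<infinity>)"
      unfolding ereal_tendsto_simps .
  qed simp
  thus ?thesis by (simp add: interval_integral_to_infinity_eq)
qed

subsection \<open>Ladder relations\<close>

text \<open>A functional with a Pearson equation of class one. Working with the functional instead of the
  integrals defining the coefficients of \<open>A\<^sub>n\<close> and \<open>B\<^sub>n\<close> avoids the integral of
  \<open>P\<^sub>n\<^sup>2 w / x\<close>, which diverges for \<open>t = 0\<close> and \<open>\<alpha> \<le> 0\<close>.\<close>

locale semiclassical_functional =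
  fixes L :: "real poly \<Rightarrow> real" and P :: "nat \<Rightarrow> real poly" and h a \<beta> :: "nat \<Rightarrow> real" and t \<alpha> :: real
  assumes L_add: "L (p + q) = L p + L q"
    and L_smult: "L (smult c p) = c * L p"
    and degree_P: "degree (P n) = n"
    and lead_coeff_P: "lead_coeff (P n) = 1"
    and L_PP: "L (P j * P k) = (if j = k then h j else 0)"
    and h_pos: "h n > 0"
    and beta_0: "\<beta> 0 = 0"
    and recurrence: "X * P n = P (Suc n) + smult (a n) (P n) + smult (\<beta> n) (P (n - 1))"
    and pearson: "L (X * X * pderiv q + (smult (\<alpha> + 2) (X * q) + smult t q - X * X * q)) = 0"
begin

section \<open>Orthogonality and the bilinear form of the functional\<close>

definition ip :: "real poly \<Rightarrow> real poly \<Rightarrow> real" where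
  "ip p q = L (p * q)"

lemma L_diff: "L (p - q) = L p - L q"
  using L_add[of "p - q" q] by simp

lemma L_0 [simp]: "L 0 = 0"
  using L_smult[of 0 0] by simp

lemma ip_simps:
  "ip (p + q) r = ip p r + ip q r" "ip r (p + q) = ip r p + ip r q"
  "ip (p - q) r = ip p r - ip q r" "ip r (p - q) = ip r p - ip r q"
  "ip (smult c p) r = c * ip p r" "ip r (smult c p) = c * ip r p"
  "ip 0 r = 0" "ip r 0 = 0"
  by (simp_all add: ip_def ring_distribs L_add L_diff L_smult)

lemma ip_commute: "ip p q = ip q p"
  by (simp add: ip_def mult.commute)

lemma ip_X_right: "ip p (X * q) = ip (X * p) q"
  by (simp add: ip_def mult_ac)

lemma ip_PP: "ip (P j) (P k) = (if j = k then h j else 0)"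
  by (simp add: ip_def L_PP)

lemma coeff_P_self: "coeff (P n) n = 1"
  using lead_coeff_P[of n] by (simp add: degree_P)

lemma coeff_P_eq_0: "i > n \<Longrightarrow> coeff (P n) i = 0"
  by (simp add: coeff_eq_0 degree_P)

lemma coeff_X_mult: "coeff (X * p) (Suc i) = coeff p i" "coeff (X * p) 0 = 0"
  by (simp_all add: coeff_monom_mult)

lemma coeff_X_pderiv: "coeff (X * pderiv p) i = real i * coeff p i"
  by (cases i) (simp_all add: coeff_X_mult coeff_pderiv)

lemma coeff_X2_pderiv: "coeff (X * (X * pderiv p)) (Suc i) = real i * coeff p i"
  by (simp add: coeff_X_mult coeff_X_pderiv)

text \<open>Subtracting a multiple of the monic \<open>P N\<close> lowers the degree bound. Degree
  below \<open>n\<close> is stated by vanishing coefficients, which at \<open>n = 0\<close>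
  correctly leaves only the zero polynomial.\<close>

lemma orthogonal_lower:
  assumes "\<And>i. i \<ge> n \<Longrightarrow> coeff q i = 0"
  shows "ip (P n) q = 0"
proof -
  have "ip (P n) q = 0" if "N \<le> n" "\<And>i. i \<ge> N \<Longrightarrow> coeff q i = 0" for N
    using that
  proof (induction N arbitrary: q)
    case 0
    hence "q = 0" by (intro poly_eqI) simp
    thus ?case by (simp add: ip_simps)
  next
    case (Suc N)
    have "ip (P n) (q - smult (coeff q N) (P N)) = 0"
    proof (rule Suc.IH)
      show "coeff (q - smult (coeff q N) (P N)) i = 0" if "i \<ge> N" for i
        using that Suc.prems(2)[of i] by (cases "i = N") (auto simp: coeff_P_self coeff_P_eq_0)
    qed (use Suc.prems in auto)
    thus ?case using Suc.prems by (simp add: ip_simps ip_PP)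
  qed
  thus ?thesis using assms by blast
qed

lemma ip_P_eq_coeff:
  assumes "\<And>i. i > n \<Longrightarrow> coeff q i = 0"
  shows "ip (P n) q = coeff q n * h n"
proof -
  have "ip (P n) (q - smult (coeff q n) (P n)) = 0"
  proof (rule orthogonal_lower)
    show "coeff (q - smult (coeff q n) (P n)) i = 0" if "i \<ge> n" for i
      using that assms[of i] by (cases "i = n") (auto simp: coeff_P_self coeff_P_eq_0)
  qed
  thus ?thesis by (simp add: ip_simps ip_PP)
qed

text \<open>A nonzero \<open>q\<close> pairs with \<open>P (degree q)\<close> to its leading
  coefficient times a positive \<open>h\<close>.\<close>

lemma eq_0_if_orthogonal:
  assumes "\<And>i. i \<ge> n \<Longrightarrow> coeff q i = 0" and "\<And>j. j < n \<Longrightarrow> ip (P j) q = 0"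
  shows "q = 0"
proof (rule ccontr)
  assume "q \<noteq> 0"
  moreover have "degree q < n"
    using assms(1)[of "degree q"] \<open>q \<noteq> 0\<close> by (meson leading_coeff_0_iff not_le)
  ultimately have "lead_coeff q * h (degree q) = 0"
    using assms(2)[of "degree q"] ip_P_eq_coeff[of "degree q" q] by (simp add: coeff_eq_0)
  thus False using \<open>q \<noteq> 0\<close> h_pos[of "degree q"] by simp
qed

lemma coeff_X_mult_P: "i > Suc n \<Longrightarrow> coeff (X * P n) i = 0"
  by (cases i) (auto simp: coeff_X_mult coeff_P_eq_0)

lemma ip_P_Suc_X: "ip (P (Suc n)) (X * P n) = h (Suc n)"
  using ip_P_eq_coeff[of "Suc n" "X * P n"] by (simp add: coeff_X_mult_P coeff_X_mult coeff_P_self)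

lemma ip_X_P:
  "ip (X * P n) q = ip (P (Suc n)) q + a n * ip (P n) q + \<beta> n * ip (P (n - 1)) q"
  unfolding recurrence ip_simps ..

text \<open>Multiplication by \<open>X\<close> is symmetric, so the pairing of
  \<open>X * P n\<close> with \<open>P (Suc n)\<close> can be computed from leading coefficients or
  from the recurrence.\<close>

lemma beta_h: "\<beta> (Suc n) * h n = h (Suc n)"
  using ip_P_Suc_X[of n] ip_X_P[of "Suc n" "P n"] by (simp add: ip_X_right ip_PP)

lemma ip_X_self: "ip (P n) (X * P n) = a n * h n"
  using ip_X_P[of n "P n"] by (cases n) (simp_all add: ip_X_right ip_PP beta_0)

text \<open>The factor \<open>\<beta> n\<close> on both sides covers \<open>n = 0\<close>, where
  \<open>n - 1\<close> is again 0 but \<open>\<beta> 0 = 0\<close>.\<close>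

lemma beta_ip_pred: "\<beta> n * ip (P (n - 1)) (X * P n) = \<beta> n * h n"
proof (cases n)
  case (Suc m)
  thus ?thesis using ip_P_Suc_X[of m] ip_X_right[of "P m" "P n"] ip_commute[of "X * P m" "P n"] by simp
qed (simp add: beta_0)

lemma ip_XX_self: "ip (X * P n) (X * P n) = ((a n)\<^sup>2 + \<beta> n + \<beta> (Suc n)) * h n"
proof -
  have "ip (X * P n) (X * P n) = \<beta> (Suc n) * h n + a n * (a n * h n) + \<beta> n * h n"
    using ip_X_P[of n "X * P n"] beta_ip_pred[of n] ip_P_Suc_X[of n] ip_X_self[of n] beta_h[of n] by metis
  thus ?thesis by (simp add: algebra_simps power2_eq_square)
qed

lemma ip_XX_Suc: "ip (X * P (Suc n)) (X * P n) = (a n + a (Suc n)) * h (Suc n)"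
proof -
  have "ip (P (Suc (Suc n))) (X * P n) = 0"
    by (rule orthogonal_lower) (simp add: coeff_X_mult_P)
  hence "ip (X * P (Suc n)) (X * P n) = a (Suc n) * h (Suc n) + a n * (\<beta> (Suc n) * h n)"
    using ip_X_P[of "Suc n" "X * P n"] by (simp add: ip_P_Suc_X ip_X_self)
  thus ?thesis unfolding beta_h by (simp add: distrib_right)
qed

text \<open>Integration by parts moving \<open>X * X * pderiv\<close> from one factor to the other:
  the Pearson equation for the product \<open>p * q\<close>, expanded by the Leibniz rule.\<close>

lemma pearson_ip:
  "ip (X * (X * pderiv p)) q = ip (X * p) (X * q) - (\<alpha> + 2) * ip (X * p) q - t * ip p q
     - ip p (X * (X * pderiv q))"
  using pearson[of "p * q"]
  by (simp add: ip_def pderiv_mult ring_distribs L_add L_diff L_smult mult_ac)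

text \<open>The case distinction is needed because for \<open>n = 0\<close> the index
  \<open>n - 1\<close> would pick up the leading coefficient 1.\<close>

definition sublead :: "nat \<Rightarrow> real" where
  "sublead n = (if n = 0 then 0 else coeff (P n) (n - 1))"

text \<open>The numerators of the ladder functions: x^2 B_n turns out to be
  \<open>r n - n x\<close>, and x^2 A_n is \<open>x + R n\<close>.\<close>

definition r :: "nat \<Rightarrow> real" where
  "r n = sublead n + \<beta> n"

definition R :: "nat \<Rightarrow> real" where
  "R n = a n - 2 * real n - 1 - \<alpha>"

lemma sublead_Suc: "sublead (Suc n) = sublead n - a n"
proof (cases n)
  case 0
  thus ?thesis using arg_cong[OF recurrence[of n], of "\<lambda>p. coeff p n"]
    by (simp add: sublead_def coeff_X_mult beta_0 coeff_P_self[of 0, simplified])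
next
  case (Suc m)
  thus ?thesis using arg_cong[OF recurrence[of n], of "\<lambda>p. coeff p n"]
    by (simp add: sublead_def coeff_X_mult coeff_P_self[of "Suc m", simplified] coeff_P_eq_0)
qed

lemma r_0: "r 0 = 0"
  by (simp add: r_def sublead_def beta_0)

lemma r_Suc: "r (Suc n) - r n = \<beta> (Suc n) - \<beta> n - a n"
  by (simp add: r_def sublead_Suc)

lemma pderiv_P_0: "pderiv (P 0) = 0"
  using degree_P[of 0] by (simp add: pderiv_eq_0_iff)

text \<open>By \<open>pearson_ip\<close> the derivative moves to \<open>P n\<close>, and x^2 P_n'
  has degree at most n + 1 with coefficient n at x^(n+1).\<close>

lemma ip_deriv_Suc:
  "ip (X * (X * pderiv (P (Suc n)))) (P n) = (a n + a (Suc n) - \<alpha> - real n - 2) * h (Suc n)"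
proof -
  have "ip (P (Suc n)) (X * (X * pderiv (P n))) = real n * h (Suc n)"
  proof (subst ip_P_eq_coeff)
    show "coeff (X * (X * pderiv (P n))) i = 0" if "i > Suc n" for i
      using that by (cases i) (auto simp: coeff_X2_pderiv coeff_P_eq_0)
  qed (simp add: coeff_X2_pderiv coeff_P_self)
  moreover have "ip (X * P (Suc n)) (P n) = h (Suc n)"
    using ip_P_Suc_X[of n] by (simp add: ip_X_right)
  ultimately show ?thesis
    by (subst pearson_ip) (simp add: ip_XX_Suc ip_PP, simp add: algebra_simps)
qed

text \<open>The difference \<open>Q\<close> of the two sides has degree below \<open>n\<close> by
  the choice of \<open>r n\<close>, and is orthogonal to all \<open>P j\<close> with
  \<open>j < n\<close>, so it vanishes.\<close>

lemma lowering:
  "X * (X * pderiv (P n)) =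
     smult (real n) (X * P n) - smult (r n) (P n) + smult (\<beta> n) (X * P (n - 1) + smult (R n) (P (n - 1)))"
proof (cases n)
  case 0
  thus ?thesis by (simp add: r_0 beta_0 pderiv_P_0)
next
  case (Suc m)
  define Q where "Q = X * (X * pderiv (P n)) - (smult (real n) (X * P n) - smult (r n) (P n) + smult (\<beta> n) (X * P m + smult (R n) (P m)))"
  have "Q = 0"
  proof (rule eq_0_if_orthogonal)
    fix i assume "i \<ge> n"
    then obtain k where k: "i = Suc k" "k \<ge> m" using Suc by (cases i) auto
    \<comment> \<open>This value of \<open>r n\<close> cancels the coefficient of x^n, which is the
      case \<open>k = m\<close>; the higher coefficients vanish identically.\<close>
    have "r n = coeff (P n) m + \<beta> n" by (simp add: r_def sublead_def Suc)
    moreover have "coeff Q i = (real k - real n) * coeff (P n) k + r n * coeff (P n) (Suc k)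
        - \<beta> n * (coeff (P m) k + R n * coeff (P m) (Suc k))"
      by (simp add: Q_def k(1) coeff_X_pderiv coeff_X_mult left_diff_distrib)
    moreover have "k = m \<or> k = n \<or> k > n" using k Suc by auto
    ultimately show "coeff Q i = 0"
      using Suc coeff_P_self[of n] coeff_P_self[of m] by (auto simp: coeff_P_eq_0)
  next
    fix j assume "j < n"
    have *: "ip (P n) (X * P j) = (if j = m then h n else 0)"
    proof (cases "j = m")
      case False
      hence "ip (P n) (X * P j) = 0"
        using \<open>j < n\<close> Suc by (intro orthogonal_lower) (auto simp: coeff_X_mult_P)
      thus ?thesis using False by simp
    qed (use ip_P_Suc_X[of m] Suc in auto)
    have Q: "ip (P j) Q = ip (X * (X * pderiv (P n))) (P j) - real n * ip (P n) (X * P j)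
        - \<beta> n * (ip (P m) (X * P j) + R n * ip (P m) (P j))"
      using \<open>j < n\<close> unfolding ip_commute[of "P j" Q]
      by (simp add: Q_def ip_simps ip_PP ip_X_right)
    show "ip (P j) Q = 0"
    \<comment> \<open>For \<open>j = m\<close> the pairing vanishes by the value of
      \<open>R n\<close>. For smaller \<open>j\<close> only the pairings of \<open>X * P j\<close>
      with \<open>X * P n\<close> and with \<open>P m\<close> survive; they cancel by
      \<open>h n = \<beta> n * h m\<close>.\<close>
    proof (cases "j = m")
      case True
      have D: "ip (X * (X * pderiv (P n))) (P m) = (a m + a n - \<alpha> - real m - 2) * h n"
        using ip_deriv_Suc[of m] by (simp add: Suc)
      have "ip (P n) (X * P m) = h n" using * True by simp
      from Q[unfolded True D this ip_X_self ip_PP]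
      have "ip (P j) Q = (a m + a n - \<alpha> - real m - 2 - real n) * h n - (a m + R n) * (\<beta> n * h m)"
        by (simp add: True) (simp add: algebra_simps)
      also have "\<beta> n * h m = h n" using beta_h[of m] by (simp add: Suc)
      finally show ?thesis by (simp add: R_def Suc algebra_simps)
    next
      case False
      with \<open>j < n\<close> Suc have jm: "j < m" by simp
      have 1: "ip (P n) (X * (X * pderiv (P j))) = 0"
      proof (rule orthogonal_lower)
        show "coeff (X * (X * pderiv (P j))) i = 0" if "i \<ge> n" for i
          using that jm Suc by (cases i) (auto simp: coeff_X_pderiv coeff_X_mult coeff_P_eq_0)
      qed
      have 2: "ip (P n) (X * (X * P j)) = coeff (X * P j) m * h n"
      proof (subst ip_P_eq_coeff)
        show "coeff (X * (X * P j)) i = 0" if "i > n" for i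
          using that jm Suc by (cases i) (auto simp: coeff_X_mult coeff_X_mult_P)
      qed (simp add: coeff_X_mult Suc)
      have 3: "ip (P m) (X * P j) = coeff (X * P j) m * h m"
        using jm by (intro ip_P_eq_coeff) (auto simp: coeff_X_mult_P)
      have 4: "ip (P n) (X * P j) = 0" "ip (P n) (P j) = 0" "ip (P m) (P j) = 0"
        using * False \<open>j < n\<close> by (simp_all add: ip_PP)
      have 5: "h n = \<beta> n * h m" using beta_h[of m] by (simp add: Suc)
      show ?thesis
        unfolding Q pearson_ip[of "P n" "P j"] ip_X_right[of "X * P n", symmetric]
          ip_X_right[of "P n", symmetric] 1 2 3 4 5 by simp
    qed
  qed
  thus ?thesis by (simp add: Q_def Suc)
qed

section \<open>Compatibility relations and the raising relation\<close>

lemma ip_deriv_self: "ip (X * (X * pderiv (P n))) (P n) = (real n * a n - r n + \<beta> n) * h n"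
proof -
  have "\<beta> n * ip (X * P (n - 1)) (P n) = \<beta> n * h n"
    using beta_ip_pred[of n] by (simp only: ip_X_right)
  moreover have "\<beta> n * ip (P (n - 1)) (P n) = 0"
    by (cases n) (simp_all add: beta_0 ip_PP)
  moreover have "ip (X * P n) (P n) = a n * h n"
    using ip_X_self[of n] by (simp only: ip_commute)
  ultimately show ?thesis
    unfolding lowering ip_simps ring_distribs mult.left_commute[of "\<beta> n" "R n"]
    by (cases n) (simp_all add: ip_PP beta_0)
qed

text \<open>For equal arguments \<open>pearson_ip\<close> gives twice the pairing of x^2 P_n' with
  P_n, which the lowering relation also evaluates. Equating the two and eliminating
  \<open>\<beta> (Suc n)\<close> by \<open>r_Suc\<close> leaves the claim.\<close>

lemma compatibility_1: "r n + r (Suc n) = t - a n * R n"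
proof -
  have "2 * ip (X * (X * pderiv (P n))) (P n) = ip (X * P n) (X * P n) - (\<alpha> + 2) * ip (X * P n) (P n) - t * h n"
    using pearson_ip[of "P n" "P n"] by (simp add: ip_PP ip_commute[of "P n" "X * (X * pderiv (P n))"])
  also have "\<dots> = ((a n)\<^sup>2 + \<beta> n + \<beta> (Suc n) - (\<alpha> + 2) * a n - t) * h n"
    using ip_X_self[of n] by (simp add: ip_XX_self ip_commute[of "X * P n" "P n"], simp add: algebra_simps)
  finally have "2 * (real n * a n - r n + \<beta> n) * h n = ((a n)\<^sup>2 + \<beta> n + \<beta> (Suc n) - (\<alpha> + 2) * a n - t) * h n"
    by (simp add: ip_deriv_self)
  hence "2 * (real n * a n - r n + \<beta> n) = (a n)\<^sup>2 + \<beta> n + \<beta> (Suc n) - (\<alpha> + 2) * a n - t"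
    using h_pos[of n] by simp
  thus ?thesis using r_Suc[of n] by (simp add: R_def algebra_simps power2_eq_square)
qed

text \<open>The recurrence is differentiated, multiplied by x^2 and paired with \<open>P n\<close>.
  The terms with the pairing of x^2 P_n' and P_n occur on both sides and cancel; the others are
  known multiples of \<open>h n\<close> and \<open>h (Suc n)\<close>.\<close>

lemma compatibility_2:
  "\<beta> (Suc n) * R (Suc n) - \<beta> n * R (n - 1) = (a n)\<^sup>2 + a n * (\<beta> n - \<beta> (Suc n))"
proof -
  let ?D = "\<lambda>n. X * (X * pderiv (P n))"
  have "X * X * pderiv (X * P n) = X * X * pderiv (P (Suc n) + smult (a n) (P n) + smult (\<beta> n) (P (n - 1)))"
    by (simp only: recurrence)
  hence eq: "X * (X * P n) + X * ?D n = ?D (Suc n) + smult (a n) (?D n) + smult (\<beta> n) (?D (n - 1))"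
    by (simp add: pderiv_mult pderiv_add pderiv_smult pderiv_monom ring_distribs monom_0 mult_ac one_pCons[symmetric])
  have "ip (X * ?D n) (P n) = ip (?D n) (P (Suc n)) + a n * ip (?D n) (P n) + \<beta> n * ip (?D n) (P (n - 1))"
    by (simp add: ip_X_right[symmetric] recurrence ip_simps)
  moreover have "ip (?D n) (P (Suc n)) = real n * h (Suc n)"
  proof (subst ip_commute, subst ip_P_eq_coeff)
    show "coeff (X * (X * pderiv (P n))) i = 0" if "i > Suc n" for i
      using that by (cases i) (auto simp: coeff_X2_pderiv coeff_P_eq_0)
  qed (simp add: coeff_X2_pderiv coeff_P_self)
  moreover have "\<beta> n * ip (?D n) (P (n - 1)) = \<beta> n * ((a (n - 1) + a n - \<alpha> - real n - 1) * h n)"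
    using ip_deriv_Suc[of "n - 1"] by (cases n) (simp_all add: beta_0)
  moreover have "\<beta> n * ip (?D (n - 1)) (P n) = \<beta> n * ((real n - 1) * h n)"
  proof (cases n)
    case (Suc m)
    have "ip (P (Suc m)) (?D m) = real m * h (Suc m)"
    proof (subst ip_P_eq_coeff)
      show "coeff (X * (X * pderiv (P m))) i = 0" if "i > Suc m" for i
        using that by (cases i) (auto simp: coeff_X2_pderiv coeff_P_eq_0)
    qed (simp add: coeff_X2_pderiv coeff_P_self)
    thus ?thesis using Suc by (simp add: ip_commute)
  qed (simp add: beta_0)
  moreover have "ip (X * (X * P n)) (P n) = ((a n)\<^sup>2 + \<beta> n + \<beta> (Suc n)) * h n"
    using ip_XX_self[of n] ip_X_right[of "X * P n" "P n"] ip_commute by simp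
  moreover have "ip (X * (X * P n)) (P n) + ip (X * ?D n) (P n)
      = ip (?D (Suc n)) (P n) + a n * ip (?D n) (P n) + \<beta> n * ip (?D (n - 1)) (P n)"
    using arg_cong[OF eq, of "\<lambda>q. ip q (P n)"] by (simp only: ip_simps)
  moreover note ip_deriv_Suc[of n]
  ultimately have "((a n)\<^sup>2 + \<beta> n + \<beta> (Suc n)) * h n + real n * (\<beta> (Suc n) * h n) + \<beta> n * ((a (n - 1) + a n - \<alpha> - real n - 1) * h n)
    = (a n + a (Suc n) - \<alpha> - real n - 2) * (\<beta> (Suc n) * h n) + \<beta> n * ((real n - 1) * h n)"
    unfolding beta_h by linarith
  hence "((a n)\<^sup>2 + \<beta> n + \<beta> (Suc n) + real n * \<beta> (Suc n) + \<beta> n * (a (n - 1) + a n - \<alpha> - real n - 1)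
    - (a n + a (Suc n) - \<alpha> - real n - 2) * \<beta> (Suc n) - \<beta> n * (real n - 1)) * h n = 0"
    by (simp add: algebra_simps)
  hence "(a n)\<^sup>2 + \<beta> n + \<beta> (Suc n) + real n * \<beta> (Suc n) + \<beta> n * (a (n - 1) + a n - \<alpha> - real n - 1)
    - (a n + a (Suc n) - \<alpha> - real n - 2) * \<beta> (Suc n) - \<beta> n * (real n - 1) = 0"
    using h_pos[of n] by simp
  thus ?thesis
    by (cases n) (simp_all add: R_def beta_0 algebra_simps)
qed

text \<open>The two compatibility relations make the difference of the two sides independent of \<open>n\<close>.\<close>
lemma r_closed_form: "(2 * real n + \<alpha>) * r n = real n * t - \<beta> n * (R n + R (n - 1))"
proof (induction n)
  case 0
  show ?case by (simp add: r_0 beta_0)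
next
  case (Suc n)
  define \<delta> where "\<delta> = r (Suc n) - r n"
  have b: "\<beta> (Suc n) = \<beta> n + a n + \<delta>" using r_Suc[of n] by (simp add: \<delta>_def)
  have t: "t = r n + r (Suc n) + a n * R n" using compatibility_1[of n] by simp
  \<comment> \<open>The square of \<open>a n\<close> cancels since
    \<open>\<beta> n - \<beta> (Suc n) = - (a n + \<delta>)\<close>.\<close>
  have s: "\<beta> (Suc n) * R (Suc n) = \<beta> n * R (n - 1) - a n * \<delta>"
    using compatibility_2[of n] unfolding b by (simp add: algebra_simps power2_eq_square)
  have "\<beta> (Suc n) * (R (Suc n) + R n) = \<beta> n * (R n + R (n - 1)) - a n * \<delta> + (a n + \<delta>) * R n"
    unfolding distrib_left[of "\<beta> (Suc n)"] s unfolding b by (simp add: algebra_simps)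
  also have "\<beta> n * (R n + R (n - 1)) = real n * t - (2 * real n + \<alpha>) * r n" using Suc.IH by simp
  finally have e: "\<beta> (Suc n) * (R (Suc n) + R n) = real n * t - (2 * real n + \<alpha>) * r n - a n * \<delta> + (a n + \<delta>) * R n" .
  have "(a n - R n) * \<delta> = (2 * real n + 1 + \<alpha>) * \<delta>" by (simp add: R_def)
  thus ?case
    unfolding diff_Suc_1 e using t by (simp add: \<delta>_def algebra_simps)
qed

text \<open>The lowering relation with \<open>\<beta> n * P (n - 1)\<close> replaced through the
  recurrence; \<open>compatibility_1\<close> simplifies the coefficient of
  \<open>P n\<close>.\<close>

lemma raising:
  "X * (X * pderiv (P n)) =
     X * (X * P n) - smult (real n + 1 + \<alpha>) (X * P n) + smult (r (Suc n) - t) (P n)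
     - (X * P (Suc n) + smult (R n) (P (Suc n)))"
proof -
  have b: "smult (\<beta> n) (P (n - 1)) = X * P n - P (Suc n) - smult (a n) (P n)"
    by (simp add: recurrence)
  have "X * (X * pderiv (P n)) = smult (real n) (X * P n) - smult (r n) (P n)
      + (X * smult (\<beta> n) (P (n - 1)) + smult (R n) (smult (\<beta> n) (P (n - 1))))"
    by (subst lowering) (simp add: smult_add_right mult.commute)
  also have "\<dots> = X * (X * P n) + smult (real n + R n - a n) (X * P n) + smult (- r n - R n * a n) (P n)
     - (X * P (Suc n) + smult (R n) (P (Suc n)))"
    unfolding b by (simp add: ring_distribs smult_add_right smult_diff_right smult_add_left smult_diff_left mult.commute)
  also have "smult (real n + R n - a n) (X * P n) = - smult (real n + 1 + \<alpha>) (X * P n)"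
  proof -
    have "real n + R n - a n = - (real n + 1 + \<alpha>)" by (simp add: R_def)
    thus ?thesis by (simp only: smult_minus_left)
  qed
  also have "- r n - R n * a n = r (Suc n) - t" using compatibility_1[of n] by (simp add: algebra_simps)
  finally show ?thesis by simp
qed

text \<open>The argument of \<open>L\<close> is the polynomial part of the integration by parts for
  the square of \<open>P n\<close>, so this value determines the remaining integral with
  \<open>t / x\<close>.\<close>

lemma L_euler:
  "L (P n * P n + X * pderiv (P n * P n) + smult \<alpha> (P n * P n) - X * (P n * P n)) = - R n * h n"
proof -
  have "ip (P n) (X * pderiv (P n)) = real n * h n"
    by (subst ip_P_eq_coeff) (simp_all add: coeff_X_pderiv coeff_P_self coeff_P_eq_0)
  moreover have "P n * P n + X * pderiv (P n * P n) + smult \<alpha> (P n * P n) - X * (P n * P n)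
      = P n * P n + (P n * (X * pderiv (P n)) + P n * (X * pderiv (P n))) + smult \<alpha> (P n * P n) - P n * (X * P n)"
    by (simp add: pderiv_mult algebra_simps)
  hence "L (P n * P n + X * pderiv (P n * P n) + smult \<alpha> (P n * P n) - X * (P n * P n))
      = ip (P n) (P n) + 2 * ip (P n) (X * pderiv (P n)) + \<alpha> * ip (P n) (P n) - ip (P n) (X * P n)"
    by (simp only: ip_def L_add L_diff L_smult)
  ultimately show ?thesis
    unfolding ip_X_self ip_PP by (simp add: R_def algebra_simps)
qed

end

subsection \<open>The differential equation\<close>

lemma has_real_derivative_ladder_A:
  assumes "x > 0"
  shows "(ladder_A \<alpha> a n has_real_derivative - 1 / x\<^sup>2 - 2 * (a n - 2 * real n - 1 - \<alpha>) / x ^ 3) (at x)"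
proof -
  have "ladder_A \<alpha> a n = (\<lambda>x. 1 / x + (a n - 2 * real n - 1 - \<alpha>) / x\<^sup>2)"
    by (simp add: ladder_A_def fun_eq_iff)
  thus ?thesis
    using assms by (auto intro!: derivative_eq_intros simp: field_simps power2_eq_square power3_eq_cube)
qed

lemma has_real_derivative_ladder_B:
  assumes "x > 0"
  shows "(ladder_B t \<alpha> a b n has_real_derivative
     real n / x\<^sup>2 - 2 * ((real n * t - b n * (a n + a (n - 1) - 4 * real n - 2 * \<alpha>)) / (2 * real n + \<alpha>)) / x ^ 3) (at x)"
proof -
  let ?\<rho> = "(real n * t - b n * (a n + a (n - 1) - 4 * real n - 2 * \<alpha>)) / (2 * real n + \<alpha>)"
  have "ladder_B t \<alpha> a b n = (\<lambda>x. - real n / x + ?\<rho> / x\<^sup>2)"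
    by (simp add: ladder_B_def fun_eq_iff)
  moreover have "((\<lambda>x. - real n / x + \<rho> / x\<^sup>2) has_real_derivative real n / x\<^sup>2 - 2 * \<rho> / x ^ 3) (at x)" for \<rho>
    using assms by (auto intro!: derivative_eq_intros simp: field_simps power2_eq_square power3_eq_cube)
  ultimately show ?thesis by (simp only:)
qed

lemma has_real_derivative_potential:
  assumes "x > 0"
  shows "(potential t \<alpha> has_real_derivative 1 - t / x\<^sup>2 - \<alpha> / x) (at x)"
proof (rule has_field_derivative_transform_within_open[where S = "{0<..}"])
  show "((\<lambda>x. x + t / x - \<alpha> * ln x) has_real_derivative 1 - t / x\<^sup>2 - \<alpha> / x) (at x)"
    using assms by (auto intro!: derivative_eq_intros simp: field_simps power2_eq_square)
  show "y + t / y - \<alpha> * ln y = potential t \<alpha> y" if "y \<in> {0<..}" for y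
    using that by (simp add: potential_def weight_def ln_mult ln_powr)
qed (use assms in auto)

text \<open>\<open>deriv f\<close> agrees with \<open>f1\<close> on the open half-line and so
  inherits its differentiability. This supplies second derivatives in the form used by
  \<open>sturm_F\<close>.\<close>

lemma has_real_derivative_deriv_deriv:
  assumes "\<And>x. x > 0 \<Longrightarrow> (f has_real_derivative f1 x) (at x)"
    and "(f1 has_real_derivative D) (at x)" and "(x::real) > 0"
  shows "(deriv f has_real_derivative deriv (deriv f) x) (at x)"
proof -
  have "(deriv f has_real_derivative D) (at x)"
    by (rule has_field_derivative_transform_within_open[OF assms(2), where S = "{0<..}"])
      (use assms in \<open>auto intro: DERIV_imp_deriv[symmetric]\<close>)
  thus ?thesis unfolding DERIV_deriv_iff_has_field_derivative by blast
qed

lemma has_real_derivative_deriv_ladder_A: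
  assumes "x > 0"
  shows "(deriv (ladder_A \<alpha> a n) has_real_derivative deriv (deriv (ladder_A \<alpha> a n)) x) (at x)"
proof (rule has_real_derivative_deriv_deriv[OF has_real_derivative_ladder_A _ assms])
  show "((\<lambda>x. - 1 / x\<^sup>2 - 2 * (a n - 2 * real n - 1 - \<alpha>) / x ^ 3) has_real_derivative
      2 / x ^ 3 + 6 * (a n - 2 * real n - 1 - \<alpha>) / x ^ 4) (at x)"
    using assms by (auto intro!: derivative_eq_intros simp: field_simps eval_nat_numeral)
qed

lemma has_real_derivative_deriv_potential:
  assumes "x > 0"
  shows "(deriv (potential t \<alpha>) has_real_derivative deriv (deriv (potential t \<alpha>)) x) (at x)"
proof (rule has_real_derivative_deriv_deriv[OF has_real_derivative_potential _ assms])
  show "((\<lambda>x. 1 - t / x\<^sup>2 - \<alpha> / x) has_real_derivative 2 * t / x ^ 3 + \<alpha> / x\<^sup>2) (at x)"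
    using assms by (auto intro!: derivative_eq_intros simp: field_simps eval_nat_numeral)
qed

lemma is_interval_einterval: "is_interval (einterval c d)"
  unfolding is_interval_1
proof (intro ballI allI impI)
  fix x y z assume "x \<in> einterval c d" "y \<in> einterval c d" "x \<le> z \<and> z \<le> y"
  thus "z \<in> einterval c d"
    unfolding einterval_iff by (meson ereal_less_eq(3) le_less_trans less_le_trans)
qed

section \<open>The given weight as an instance of the functional\<close>

locale singular_laguerre =
  fixes t \<alpha> :: real and P :: "nat \<Rightarrow> real poly" and a b :: "nat \<Rightarrow> real"
  assumes alpha: "\<alpha> > -1" and t: "t \<ge> 0"
    and orthogonal: "monic_orthogonal (weight t \<alpha>) P"
    and rec: "recurrence_coeffs P a b"
begin

definition L :: "real poly \<Rightarrow> real" where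
  "L q = (LBINT x:{0<..}. poly q x * weight t \<alpha> x)"

definition h :: "nat \<Rightarrow> real" where
  "h n = L (P n * P n)"

text \<open>\<open>b 0\<close> is arbitrary; the value 0 makes the recurrence hold at
  \<open>n = 0\<close> too, where \<open>P (n - 1)\<close> is \<open>P 0\<close>.\<close>

definition \<beta> :: "nat \<Rightarrow> real" where
  "\<beta> n = (if n = 0 then 0 else b n)"

lemma L_pearson:
  "L (q + X * pderiv q + smult \<alpha> q - X * q) + (LBINT x:{0<..}. poly q x * (t / x * weight t \<alpha> x)) = 0"
  unfolding L_def
  using set_integral_add(2)[OF set_integrable_poly_weight[OF alpha t, of "q + X * pderiv q + smult \<alpha> q - X * q"]
      set_integrable_poly_weight_div[OF alpha t, of q]]
    weight_integral_by_parts[OF alpha t, of q]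
  by (rule trans[OF sym])

sublocale semiclassical_functional L P h a \<beta> t \<alpha>
proof
  obtain h' where h': "\<And>j. h' j > 0"
    "\<And>j k. (LBINT x:{0<..}. poly (P j) x * poly (P k) x * weight t \<alpha> x) = (if j = k then h' j else 0)"
    using orthogonal by (auto simp: monic_orthogonal_def)
  have LPP: "L (P j * P k) = (if j = k then h' j else 0)" for j k
    using h'(2)[of j k] by (simp add: L_def)
  fix n j k :: nat and p q :: "real poly" and c :: real
  show "L (P j * P k) = (if j = k then h j else 0)" "h n > 0"
    using h'(1) by (auto simp: h_def LPP)
  show L_add: "L (p + q) = L p + L q" for p q
    by (simp add: L_def distrib_right set_integral_add set_integrable_poly_weight alpha t)
  show "L (smult c p) = c * L p" for c p
    by (simp add: L_def mult.assoc)
  show "degree (P n) = n" "lead_coeff (P n) = 1"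
    using orthogonal unfolding monic_orthogonal_def by blast+
  show "\<beta> 0 = 0" by (simp add: \<beta>_def)
  show "X * P n = P (Suc n) + smult (a n) (P n) + smult (\<beta> n) (P (n - 1))"
  proof -
    have "[:0, 1:] * P n = P (n + 1) + smult (a n) (P n) + (if n = 0 then 0 else smult (b n) (P (n - 1)))"
      using rec unfolding recurrence_coeffs_def by blast
    moreover have "[:0, 1:] = X" by (simp add: monom_Suc monom_0)
    ultimately show ?thesis by (cases "n = 0") (simp_all add: \<beta>_def)
  qed
  have X2: "smult (\<alpha> + 2) (X * q) = smult \<alpha> (X * q) + (X * q + X * q)"
    by (intro poly_eqI) (simp only: coeff_smult coeff_add distrib_right mult_2)
  have DX: "pderiv (X * q) = X * pderiv q + q"
    by (simp add: pderiv_mult pderiv_monom monom_0 flip: one_pCons)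
  \<comment> \<open>Integration by parts is applied to \<open>X * q\<close>, whose factor x cancels
    the denominator of \<open>t / x\<close> and leaves the polynomial
    \<open>smult t q\<close>.\<close>
  have "X * X * pderiv q + (smult (\<alpha> + 2) (X * q) + smult t q - X * X * q)
      = (X * q + X * pderiv (X * q) + smult \<alpha> (X * q) - X * (X * q)) + smult t q"
    unfolding X2 DX distrib_left mult.assoc by (simp only: diff_conv_add_uminus ac_simps)
  also have "L \<dots> = L (X * q + X * pderiv (X * q) + smult \<alpha> (X * q) - X * (X * q)) + L (smult t q)"
    by (rule L_add)
  also have "L (smult t q) = (LBINT x:{0<..}. poly (X * q) x * (t / x * weight t \<alpha> x))"
    unfolding L_def by (intro set_lebesgue_integral_cong) (auto simp: poly_monom)
  also note L_pearson[of "X * q"]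
  finally show "L (X * X * pderiv q + (smult (\<alpha> + 2) (X * q) + smult t q - X * X * q)) = 0" .
qed

text \<open>\<open>R n * h n\<close> is the integral of \<open>t (P n)\<^sup>2 w / x\<close>, by the Pearson equation for \<open>(P n)\<^sup>2\<close>.\<close>
lemma R_nonneg: "R n \<ge> 0"
proof -
  have "(LBINT x:{0<..}. poly (P n * P n) x * (t / x * weight t \<alpha> x)) \<ge> 0"
    unfolding set_lebesgue_integral_def using t
    by (intro integral_nonneg_AE AE_I2) (auto simp: indicator_def weight_def)
  hence "R n * h n \<ge> 0"
    using L_pearson[of "P n * P n"] L_euler[of n] by simp
  thus ?thesis using h_pos[of n] by (simp add: zero_le_mult_iff)
qed

lemma ladder_A_eq: "x > 0 \<Longrightarrow> x\<^sup>2 * ladder_A \<alpha> a n x = x + R n"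
  by (simp add: ladder_A_def R_def distrib_left) (simp add: power2_eq_square)

lemma ladder_A_pos: "x > 0 \<Longrightarrow> ladder_A \<alpha> a n x > 0"
proof -
  assume "x > 0"
  hence "x\<^sup>2 * ladder_A \<alpha> a n x > 0" using R_nonneg[of n] by (simp only: ladder_A_eq)
  thus ?thesis using \<open>x > 0\<close> by (simp only: zero_less_mult_iff) auto
qed

text \<open>This is \<open>r_closed_form\<close> divided by 2n + \<alpha>, which is positive since n
  \<ge> 1 and \<alpha> > -1.\<close>

lemma ladder_B_eq:
  assumes "x > 0" "n \<ge> 1"
  shows "x\<^sup>2 * ladder_B t \<alpha> a b n x = r n - real n * x"
proof -
  have "2 * real n + \<alpha> > 0" using alpha assms(2) by linarith
  moreover have "a n + a (n - 1) - 4 * real n - 2 * \<alpha> = R n + R (n - 1)"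
    using assms(2) by (simp add: R_def of_nat_diff)
  ultimately have "(real n * t - b n * (a n + a (n - 1) - 4 * real n - 2 * \<alpha>)) / (2 * real n + \<alpha>) = r n"
    using r_closed_form[of n] assms(2) by (simp add: \<beta>_def field_simps)
  moreover have "ladder_B t \<alpha> a b n x = - real n / x
      + (real n * t - b n * (a n + a (n - 1) - 4 * real n - 2 * \<alpha>)) / (2 * real n + \<alpha>) / x\<^sup>2"
    by (simp add: ladder_B_def)
  ultimately show ?thesis using assms(1) by (simp add: field_simps power2_eq_square)
qed

lemma deriv_P:
  assumes "x > 0" "n \<ge> 1"
  shows "(poly (P n) has_real_derivative
    - ladder_B t \<alpha> a b n x * poly (P n) x + b n * ladder_A \<alpha> a n x * poly (P (n - 1)) x) (at x)"
proof (rule DERIV_cong[OF poly_DERIV])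
  have "x\<^sup>2 * poly (pderiv (P n)) x = real n * (x * poly (P n) x) - r n * poly (P n) x
      + b n * (x * poly (P (n - 1)) x + R n * poly (P (n - 1)) x)"
    using arg_cong[OF lowering[of n], of "\<lambda>p. poly p x"] assms(2) by (simp add: poly_monom \<beta>_def power2_eq_square)
  also have "\<dots> = - (r n - real n * x) * poly (P n) x + b n * (x + R n) * poly (P (n - 1)) x"
    by (simp add: algebra_simps)
  also have "\<dots> = x\<^sup>2 * (- ladder_B t \<alpha> a b n x * poly (P n) x + b n * ladder_A \<alpha> a n x * poly (P (n - 1)) x)"
    unfolding ladder_A_eq[OF assms(1), symmetric] ladder_B_eq[OF assms, symmetric] by (simp add: algebra_simps)
  finally show "poly (pderiv (P n)) x
    = - ladder_B t \<alpha> a b n x * poly (P n) x + b n * ladder_A \<alpha> a n x * poly (P (n - 1)) x"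
    using assms(1) by simp
qed

text \<open>The raising relation at index \<open>n - 1\<close>, divided by x^2; the terms x^2 - t -
  \<alpha> x combine to x^2 v'.\<close>

lemma deriv_P_pred:
  assumes "x > 0" "n \<ge> 1"
  shows "(poly (P (n - 1)) has_real_derivative
    (ladder_B t \<alpha> a b n x + deriv (potential t \<alpha>) x) * poly (P (n - 1)) x
      - ladder_A \<alpha> a (n - 1) x * poly (P n) x) (at x)"
proof (rule DERIV_cong[OF poly_DERIV])
  let ?v' = "deriv (potential t \<alpha>) x"
  have v': "x\<^sup>2 * ?v' = x\<^sup>2 - t - \<alpha> * x"
    unfolding DERIV_imp_deriv[OF has_real_derivative_potential[OF assms(1)]] using assms(1)
    by (simp add: field_simps power2_eq_square)
  have "x\<^sup>2 * poly (pderiv (P (n - 1))) x = x\<^sup>2 * poly (P (n - 1)) x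
      - (real n + \<alpha>) * (x * poly (P (n - 1)) x) + (r n - t) * poly (P (n - 1)) x
      - (x * poly (P n) x + R (n - 1) * poly (P n) x)"
    using arg_cong[OF raising[of "n - 1"], of "\<lambda>p. poly p x"] assms(2)
    by (simp add: poly_monom of_nat_diff power2_eq_square)
  also have "\<dots> = ((r n - real n * x) + (x\<^sup>2 - t - \<alpha> * x)) * poly (P (n - 1)) x - (x + R (n - 1)) * poly (P n) x"
    by (simp add: algebra_simps)
  also have "\<dots> = x\<^sup>2 * ((ladder_B t \<alpha> a b n x + ?v') * poly (P (n - 1)) x - ladder_A \<alpha> a (n - 1) x * poly (P n) x)"
    unfolding ladder_A_eq[OF assms(1), symmetric] ladder_B_eq[OF assms, symmetric] v'[symmetric]
    by (simp add: algebra_simps)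
  finally show "poly (pderiv (P (n - 1))) x
    = (ladder_B t \<alpha> a b n x + ?v') * poly (P (n - 1)) x - ladder_A \<alpha> a (n - 1) x * poly (P n) x"
    using assms(1) by simp
qed

text \<open>The normal form for the system of \<open>P n\<close> and \<open>P (n - 1)\<close>; the
  factor multiplying \<open>P n\<close> is never zero because \<open>ladder_A\<close> is
  positive.\<close>

lemma sturm_normal_form:
  assumes "n \<ge> 1"
  obtains u u' where
    "\<And>x. x > 0 \<Longrightarrow> (u has_real_derivative u' x) (at x)"
    "\<And>x. x > 0 \<Longrightarrow> (u' has_real_derivative - sturm_F t \<alpha> a b n x * u x) (at x)"
    "\<And>x. x > 0 \<Longrightarrow> u x = 0 \<longleftrightarrow> poly (P n) x = 0"
proof (rule that)
  fix x :: real assume x: "x > 0"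
  let ?A = "ladder_A \<alpha> a n" and ?B = "ladder_B t \<alpha> a b n" and ?v = "potential t \<alpha>"
  have A: "(?A has_real_derivative deriv ?A x) (at x)"
    unfolding DERIV_deriv_iff_has_field_derivative using has_real_derivative_ladder_A[OF x] by blast
  have B: "(?B has_real_derivative deriv ?B x) (at x)"
    unfolding DERIV_deriv_iff_has_field_derivative using has_real_derivative_ladder_B[OF x] by blast
  have v: "(?v has_real_derivative deriv ?v x) (at x)"
    unfolding DERIV_deriv_iff_has_field_derivative using has_real_derivative_potential[OF x] by blast
  note nf = ladder_normal_form[where A = ?A and A' = "deriv ?A" and A'' = "deriv (deriv ?A)"
      and B = ?B and B' = "deriv ?B" and v = ?v and v' = "deriv ?v" and v'' = "deriv (deriv ?v)"
      and p = "poly (P n)" and q = "poly (P (n - 1))" and C = "ladder_A \<alpha> a (n - 1)" and \<beta> = "b n", OF ladder_A_pos[OF x] A has_real_derivative_deriv_ladder_A[OF x] B v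
      has_real_derivative_deriv_potential[OF x] deriv_P[OF x assms] deriv_P_pred[OF x assms]]
  let ?\<phi> = "\<lambda>x. exp (- ?v x / 2) / sqrt (?A x)"
  show "((\<lambda>x. poly (P n) x * ?\<phi> x) has_real_derivative
      (- ?B x * poly (P n) x + b n * ?A x * poly (P (n - 1)) x - (deriv ?v x + deriv ?A x / ?A x) / 2 * poly (P n) x) * ?\<phi> x) (at x)"
    by (rule nf(1))
  show "((\<lambda>x. (- ?B x * poly (P n) x + b n * ?A x * poly (P (n - 1)) x - (deriv ?v x + deriv ?A x / ?A x) / 2 * poly (P n) x) * ?\<phi> x)
      has_real_derivative - sturm_F t \<alpha> a b n x * (poly (P n) x * ?\<phi> x)) (at x)"
    unfolding sturm_F_def Let_def by (rule nf(2))
  show "poly (P n) x * ?\<phi> x = 0 \<longleftrightarrow> poly (P n) x = 0"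
    using ladder_A_pos[OF x, of n] by simp
qed

end

theorem theorem3p4:
  fixes t \<alpha> :: real and n m :: nat
    and P :: "nat \<Rightarrow> real poly" and a b :: "nat \<Rightarrow> real"
    and c d :: ereal and y :: "nat \<Rightarrow> real"
  assumes "\<alpha> > -1" and "t \<ge> 0" and "n \<ge> 1"
    and "monic_orthogonal (weight t \<alpha>) P"
    and "recurrence_coeffs P a b"
    and "c < d" and "einterval c d \<subseteq> {0<..}"
    and "strict_mono_on {1..m} y"
    and "y ` {1..m} = {x \<in> einterval c d. poly (P n) x = 0}"
  shows
    "(\<forall>M1>0. (\<forall>x\<in>einterval c d. sturm_F t \<alpha> a b n x < M1) \<longrightarrow>
        (\<forall>k\<ge>1. k + 1 \<le> m \<longrightarrow> y (k + 1) - y k > pi / sqrt M1)) \<and>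
     (\<forall>M2>0. (\<forall>x\<in>einterval c d. sturm_F t \<alpha> a b n x > M2) \<longrightarrow>
        (\<forall>k\<ge>1. k + 1 \<le> m \<longrightarrow> y (k + 1) - y k < pi / sqrt M2)) \<and>
     (strict_mono_on (einterval c d) (sturm_F t \<alpha> a b n) \<longrightarrow>
        (\<forall>k\<ge>1. k + 2 \<le> m \<longrightarrow> y (k + 2) - 2 * y (k + 1) + y k < 0)) \<and>
     (strict_antimono_on (einterval c d) (sturm_F t \<alpha> a b n) \<longrightarrow>
        (\<forall>k\<ge>1. k + 2 \<le> m \<longrightarrow> y (k + 2) - 2 * y (k + 1) + y k > 0))"
proof -
  interpret singular_laguerre t \<alpha> P a b
    using assms(1,2,4,5) by unfold_locales
  let ?I = "einterval c d" and ?F = "sturm_F t \<alpha> a b n"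
  obtain u u' where u: "\<And>x. x > 0 \<Longrightarrow> (u has_real_derivative u' x) (at x)"
    and u': "\<And>x. x > 0 \<Longrightarrow> (u' has_real_derivative - ?F x * u x) (at x)"
    and zero_iff: "\<And>x. x > 0 \<Longrightarrow> u x = 0 \<longleftrightarrow> poly (P n) x = 0"
    using sturm_normal_form[OF \<open>n \<ge> 1\<close>] by blast
  have uI: "\<And>x. x \<in> ?I \<Longrightarrow> (u has_real_derivative u' x) (at x)"
    and uI': "\<And>x. x \<in> ?I \<Longrightarrow> (u' has_real_derivative - ?F x * u x) (at x)"
    using u u' assms(7) by auto
  have mem: "y k \<in> ?I" "u (y k) = 0" if "k \<in> {1..m}" for k
  proof -
    have "y k \<in> {x \<in> ?I. poly (P n) x = 0}" using that assms(9) by blast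
    thus "y k \<in> ?I" "u (y k) = 0" using assms(7) zero_iff[of "y k"] by auto
  qed
  have step: "y k < y (Suc k)" if "k \<ge> 1" "Suc k \<le> m" for k
    using assms(8) that by (auto simp: strict_mono_on_def)
  \<comment> \<open>A zero between \<open>y k\<close> and \<open>y (Suc k)\<close> would be some
    \<open>y j\<close> with \<open>j\<close> strictly between \<open>k\<close> and
    \<open>Suc k\<close>.\<close>
  have nz: "u x \<noteq> 0" if k: "k \<ge> 1" "Suc k \<le> m" and x: "x \<in> {y k<..<y (Suc k)}" for k x
  proof
    assume "u x = 0"
    have "x \<in> ?I"
      using mem_is_interval_1_I[OF is_interval_einterval mem(1)[of k] mem(1)[of "Suc k"]] k x by auto
    with \<open>u x = 0\<close> have "x \<in> y ` {1..m}"
      using assms(7,9) zero_iff[of x] by auto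
    then obtain j where j: "j \<in> {1..m}" "x = y j" by auto
    have "k < j" "j < Suc k"
      using strict_mono_on_less[OF assms(8)] j k x by auto
    thus False by simp
  qed
  note sturm = is_interval_einterval[of c d] uI uI'
  have "y (k + 1) - y k > pi / sqrt M" if "M > 0" "\<forall>x\<in>?I. ?F x < M" "k \<ge> 1" "k + 1 \<le> m" for M k
    using zero_gap_greater[OF sturm, of "y k" "y (Suc k)" M] that mem step nz[of k] by auto
  moreover have "y (k + 1) - y k < pi / sqrt M" if "M > 0" "\<forall>x\<in>?I. ?F x > M" "k \<ge> 1" "k + 1 \<le> m" for M k
    using zero_gap_less[OF sturm, of "y k" "y (Suc k)" M] that mem step nz[of k] by auto
  \<comment> \<open>The second difference is the gap after \<open>y (k + 1)\<close> minus the gap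
    before it.\<close>
  moreover have "y (k + 2) - 2 * y (k + 1) + y k < 0" if "strict_mono_on ?I ?F" "k \<ge> 1" "k + 2 \<le> m" for k
    using zero_gaps_decrease[OF sturm, of "y k" "y (Suc (Suc k))" "y (Suc k)"] that mem step
      nz[of k] nz[of "Suc k"] by auto
  moreover have "y (k + 2) - 2 * y (k + 1) + y k > 0" if "strict_antimono_on ?I ?F" "k \<ge> 1" "k + 2 \<le> m" for k
    using zero_gaps_increase[OF sturm, of "y k" "y (Suc (Suc k))" "y (Suc k)"] that mem step
      nz[of k] nz[of "Suc k"] by auto
  ultimately show ?thesis by blast
qed

end
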